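(* Let $F$ be a fuzzy formula of signature $\sigma$ containing no strong negation (and whose only fuzzy negation operator is $\neg_s(x)=1-x$). Then any fuzzy equilibrium model $V$ of $F$ satisfies $V^+(h,a)=V^+(t,a)=1$ for all atoms $a\in\sigma$.
   Context: Fuzzy formulas. A signature $\sigma$ is a set of symbols (fuzzy atoms). Fuzzy formulas (without strong negation) are built from atoms of $\sigma$ and numeric constants $c\in[0,1]$ using the fuzzy negation $\neg=\neg_s$, $\neg_s(x)=1-x$, fuzzy conjunctions $\otimes$, disjunctions $\oplus$ and implications $\rightarrow$ (several different ones may occur), identified with functions $[0,1]^2\to[0,1]$ such that (monotonicity being non-strict): $\otimes$ is increasing in both arguments, commutative, associative, $\otimes(1,x)=x$; $\oplus$ is increasing in both arguments, commutative, associative, $\oplus(0,x)=x$; $\rightarrow$ is decreasing in its first and increasing in its second argument, $\rightarrow\!(1,x)=x$, $\rightarrow\!(0,0)=1$. Infix notation is used for values as well. Fuzzy equilibrium logic. A (fuzzy N5) valuation $V$ of $\sigma$ maps $\{h,t\}\times\sigma$ to closed subintervals of $[0,1]$ with $V(t,a)\subseteq V(h,a)$ for each $a\in\sigma$. $V^-$ and $V^+$ denote lower and upper bounds of the interval. $V$ is extended to formulas ($w\in\{h,t\}$) by: $V(w,c)=[c,c]$; $V(w,F\odot G)=[V^-(w,F)\odot V^-(w,G),\,V^+(w,F)\odot V^+(w,G)]$ for $\odot\in\{\otimes,\oplus\}$; $V(h,\neg F)=[1-V^-(t,F),\,1-V^-(h,F)]$; $V(t,\neg F)=[1-V^-(t,F),\,1-V^-(t,F)]$;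 $V(h,F\rightarrow G)=[\min(V^-(h,F)\rightarrow V^-(h,G),\,V^-(t,F)\rightarrow V^-(t,G)),\ V^-(h,F)\rightarrow V^+(h,G)]$; $V(t,F\rightarrow G)=[V^-(t,F)\rightarrow V^-(t,G),\,V^-(t,F)\rightarrow V^+(t,G)]$. $V$ is a model of $F$ if $V^-(h,F)=1$. $V'\preceq V$ means $V'(t,a)=V(t,a)$ and $V(h,a)\subseteq V'(h,a)$ for all atoms $a$; $V'\prec V$ means $V'\preceq V$ and $V'\ne V$. A model $V$ of $F$ is h-minimal if there is no model $V'$ of $F$ with $V'\prec V$. A fuzzy equilibrium model of $F$ is an h-minimal model $V$ of $F$ with $V(h,a)=V(t,a)$ for all atoms $a$. *)

theory Defs
  imports "HOL-Library.Interval" "HOL-Library.FuncSet"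
begin

text \<open>
  Operators on the unit interval are total functions on the reals; only their restriction to
  the unit interval is constrained and used.
\<close>

definition fuzzy_conj :: "(real \<Rightarrow> real \<Rightarrow> real) \<Rightarrow> bool" where
  "fuzzy_conj f \<longleftrightarrow>
     f \<in> {0..1} \<rightarrow> {0..1} \<rightarrow> {0..1} \<and>
     (\<forall>y\<in>{0..1}. mono_on {0..1} (\<lambda>x. f x y)) \<and>
     (\<forall>x\<in>{0..1}. mono_on {0..1} (\<lambda>y. f x y)) \<and>
     (\<forall>x\<in>{0..1}. \<forall>y\<in>{0..1}. f x y = f y x) \<and>
     (\<forall>x\<in>{0..1}. \<forall>y\<in>{0..1}. \<forall>z\<in>{0..1}. f (f x y) z = f x (f y z)) \<and>
     (\<forall>x\<in>{0..1}. f 1 x = x)"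

definition fuzzy_disj :: "(real \<Rightarrow> real \<Rightarrow> real) \<Rightarrow> bool" where
  "fuzzy_disj f \<longleftrightarrow>
     f \<in> {0..1} \<rightarrow> {0..1} \<rightarrow> {0..1} \<and>
     (\<forall>y\<in>{0..1}. mono_on {0..1} (\<lambda>x. f x y)) \<and>
     (\<forall>x\<in>{0..1}. mono_on {0..1} (\<lambda>y. f x y)) \<and>
     (\<forall>x\<in>{0..1}. \<forall>y\<in>{0..1}. f x y = f y x) \<and>
     (\<forall>x\<in>{0..1}. \<forall>y\<in>{0..1}. \<forall>z\<in>{0..1}. f (f x y) z = f x (f y z)) \<and>
     (\<forall>x\<in>{0..1}. f 0 x = x)"

definition fuzzy_impl :: "(real \<Rightarrow> real \<Rightarrow> real) \<Rightarrow> bool" where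
  "fuzzy_impl f \<longleftrightarrow>
     f \<in> {0..1} \<rightarrow> {0..1} \<rightarrow> {0..1} \<and>
     (\<forall>y\<in>{0..1}. antimono_on {0..1} (\<lambda>x. f x y)) \<and>
     (\<forall>x\<in>{0..1}. mono_on {0..1} (\<lambda>y. f x y)) \<and>
     (\<forall>x\<in>{0..1}. f 1 x = x) \<and>
     f 0 0 = 1"

text \<open>
  Each binary connective carries its truth function, so several different operators of a kind
  may occur in one formula. There is no constructor for strong negation, and the standard
  negation is the only negation.
\<close>

datatype 'a fuzzy =
    Atom 'a
  | Const real
  | Neg "'a fuzzy"
  | Conj "real \<Rightarrow> real \<Rightarrow> real" "'a fuzzy" "'a fuzzy"
  | Disj "real \<Rightarrow> real \<Rightarrow> real" "'a fuzzy" "'a fuzzy"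
  | Impl "real \<Rightarrow> real \<Rightarrow> real" "'a fuzzy" "'a fuzzy"

inductive_set fuzzy_formulas :: "'a set \<Rightarrow> 'a fuzzy set" for \<sigma> :: "'a set" where
  atom: "a \<in> \<sigma> \<Longrightarrow> Atom a \<in> fuzzy_formulas \<sigma>"
| const: "c \<in> {0..1} \<Longrightarrow> Const c \<in> fuzzy_formulas \<sigma>"
| neg: "F \<in> fuzzy_formulas \<sigma> \<Longrightarrow> Neg F \<in> fuzzy_formulas \<sigma>"
| conj: "fuzzy_conj f \<Longrightarrow> F \<in> fuzzy_formulas \<sigma> \<Longrightarrow> G \<in> fuzzy_formulas \<sigma>
    \<Longrightarrow> Conj f F G \<in> fuzzy_formulas \<sigma>"
| disj: "fuzzy_disj f \<Longrightarrow> F \<in> fuzzy_formulas \<sigma> \<Longrightarrow> G \<in> fuzzy_formulas \<sigma>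
    \<Longrightarrow> Disj f F G \<in> fuzzy_formulas \<sigma>"
| impl: "fuzzy_impl f \<Longrightarrow> F \<in> fuzzy_formulas \<sigma> \<Longrightarrow> G \<in> fuzzy_formulas \<sigma>
    \<Longrightarrow> Impl f F G \<in> fuzzy_formulas \<sigma>"

datatype world = Here | There

type_synonym 'a valuation = "world \<times> 'a \<Rightarrow> real interval"

text \<open>
  Valuations are extensional, so that equality of two valuations of the same signature is
  equality as maps on worlds and atoms of the signature.
\<close>

definition valuations :: "'a set \<Rightarrow> 'a valuation set" where
  "valuations \<sigma> =
     {V \<in> UNIV \<times> \<sigma> \<rightarrow>\<^sub>E {I. set_of I \<subseteq> {0..1}}.
        \<forall>a\<in>\<sigma>. set_of (V (There, a)) \<subseteq> set_of (V (Here, a))}"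

text \<open>
  The term \<open>Interval (l, u)\<close> denotes the closed interval from \<open>l\<close> to \<open>u\<close> only if
  \<open>l \<le> u\<close>. For valuations and formulas of a common signature this always holds, see
  \<open>extend_bounds\<close> below.
\<close>

fun extend :: "'a valuation \<Rightarrow> world \<Rightarrow> 'a fuzzy \<Rightarrow> real interval" where
  "extend V w (Atom a) = V (w, a)"
| "extend V w (Const c) = Interval (c, c)"
| "extend V w (Conj f F G) =
     Interval (f (lower (extend V w F)) (lower (extend V w G)),
               f (upper (extend V w F)) (upper (extend V w G)))"
| "extend V w (Disj f F G) =
     Interval (f (lower (extend V w F)) (lower (extend V w G)),
               f (upper (extend V w F)) (upper (extend V w G)))"
| "extend V Here (Neg F) =
     Interval (1 - lower (extend V There F), 1 - lower (extend V Here F))"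
| "extend V There (Neg F) =
     Interval (1 - lower (extend V There F), 1 - lower (extend V There F))"
| "extend V Here (Impl f F G) =
     Interval (min (f (lower (extend V Here F)) (lower (extend V Here G)))
                   (f (lower (extend V There F)) (lower (extend V There G))),
               f (lower (extend V Here F)) (upper (extend V Here G)))"
| "extend V There (Impl f F G) =
     Interval (f (lower (extend V There F)) (lower (extend V There G)),
               f (lower (extend V There F)) (upper (extend V There G)))"

definition model :: "'a set \<Rightarrow> 'a fuzzy \<Rightarrow> 'a valuation \<Rightarrow> bool" where
  "model \<sigma> F V \<longleftrightarrow> V \<in> valuations \<sigma> \<and> lower (extend V Here F) = 1"

definition preceq :: "'a set \<Rightarrow> 'a valuation \<Rightarrow> 'a valuation \<Rightarrow> bool" where
  "preceq \<sigma> V' V \<longleftrightarrow>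
     (\<forall>a\<in>\<sigma>. V' (There, a) = V (There, a) \<and> set_of (V (Here, a)) \<subseteq> set_of (V' (Here, a)))"

definition prec :: "'a set \<Rightarrow> 'a valuation \<Rightarrow> 'a valuation \<Rightarrow> bool" where
  "prec \<sigma> V' V \<longleftrightarrow> preceq \<sigma> V' V \<and> V' \<noteq> V"

definition h_minimal_model :: "'a set \<Rightarrow> 'a fuzzy \<Rightarrow> 'a valuation \<Rightarrow> bool" where
  "h_minimal_model \<sigma> F V \<longleftrightarrow> model \<sigma> F V \<and> \<not> (\<exists>V'. model \<sigma> F V' \<and> prec \<sigma> V' V)"

definition fuzzy_equilibrium_model :: "'a set \<Rightarrow> 'a fuzzy \<Rightarrow> 'a valuation \<Rightarrow> bool" where
  "fuzzy_equilibrium_model \<sigma> F V \<longleftrightarrow>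
     h_minimal_model \<sigma> F V \<and> (\<forall>a\<in>\<sigma>. V (Here, a) = V (There, a))"

lemma bounds_Interval:
  fixes l u :: real
  assumes "l \<le> u"
  shows "lower (Interval (l, u)) = l" "upper (Interval (l, u)) = u"
  using assms by (simp_all add: lower.rep_eq upper.rep_eq Interval_inverse)

lemma
  assumes "fuzzy_conj f \<or> fuzzy_disj f"
  shows conj_disj_unit: "x \<in> {0..1} \<Longrightarrow> y \<in> {0..1} \<Longrightarrow> 0 \<le> f x y \<and> f x y \<le> 1"
    and conj_disj_mono: "0 \<le> x \<Longrightarrow> x \<le> x' \<Longrightarrow> x' \<le> 1 \<Longrightarrow> 0 \<le> y \<Longrightarrow> y \<le> y' \<Longrightarrow> y' \<le> 1
      \<Longrightarrow> f x y \<le> f x' y'"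
proof -
  have P: "f \<in> {0..1} \<rightarrow> {0..1} \<rightarrow> {0..1}"
    and 1: "\<And>y. y\<in>{0..1} \<Longrightarrow> mono_on {0..1} (\<lambda>x. f x y)"
    and 2: "\<And>x. x\<in>{0..1} \<Longrightarrow> mono_on {0..1} (\<lambda>y. f x y)"
    using assms unfolding fuzzy_conj_def fuzzy_disj_def by blast+
  show "0 \<le> f x y \<and> f x y \<le> 1" if "x \<in> {0..1}" "y \<in> {0..1}"
    using funcset_mem[OF funcset_mem[OF P that(1)] that(2)] by simp
  show "f x y \<le> f x' y'"
    if "0 \<le> x" "x \<le> x'" "x' \<le> 1" "0 \<le> y" "y \<le> y'" "y' \<le> 1"
  proof -
    have "f x y \<le> f x' y" using 1[of y] that by (auto simp: monotone_on_def)
    also have "\<dots> \<le> f x' y'" using 2[of x'] that by (auto simp: monotone_on_def)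
    finally show ?thesis .
  qed
qed

lemma
  assumes "fuzzy_impl f"
  shows impl_unit: "x \<in> {0..1} \<Longrightarrow> y \<in> {0..1} \<Longrightarrow> 0 \<le> f x y \<and> f x y \<le> 1"
    and impl_mono: "0 \<le> x' \<Longrightarrow> x' \<le> x \<Longrightarrow> x \<le> 1 \<Longrightarrow> 0 \<le> y \<Longrightarrow> y \<le> y' \<Longrightarrow> y' \<le> 1
      \<Longrightarrow> f x y \<le> f x' y'"
proof -
  have P: "f \<in> {0..1} \<rightarrow> {0..1} \<rightarrow> {0..1}"
    and 1: "\<And>y. y\<in>{0..1} \<Longrightarrow> antimono_on {0..1} (\<lambda>x. f x y)"
    and 2: "\<And>x. x\<in>{0..1} \<Longrightarrow> mono_on {0..1} (\<lambda>y. f x y)"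
    using assms unfolding fuzzy_impl_def by blast+
  show "0 \<le> f x y \<and> f x y \<le> 1" if "x \<in> {0..1}" "y \<in> {0..1}"
    using funcset_mem[OF funcset_mem[OF P that(1)] that(2)] by simp
  show "f x y \<le> f x' y'"
    if "0 \<le> x'" "x' \<le> x" "x \<le> 1" "0 \<le> y" "y \<le> y'" "y' \<le> 1"
  proof -
    have "f x y \<le> f x' y" using 1[of y] that by (auto simp: monotone_on_def)
    also have "\<dots> \<le> f x' y'" using 2[of x'] that by (auto simp: monotone_on_def)
    finally show ?thesis .
  qed
qed

lemma extend_ordered:
  assumes "F \<in> fuzzy_formulas \<sigma>" "V \<in> valuations \<sigma>"
  shows "0 \<le> lower (extend V Here F) \<and> lower (extend V Here F) \<le> lower (extend V There F)
    \<and> upper (extend V There F) \<le> upper (extend V Here F) \<and> upper (extend V Here F) \<le> 1"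
  using assms(1)
proof induction
  case (atom a)
  have "set_of (V (Here, a)) \<subseteq> {0..1}" "set_of (V (There, a)) \<subseteq> set_of (V (Here, a))"
    using assms(2) atom by (auto simp: valuations_def PiE_def Pi_def)
  then show ?case by (auto simp: set_of_eq)
next
  case (const c)
  then show ?case by (simp add: bounds_Interval)
next
  case (neg F)
  moreover have "lower (extend V There F) \<le> upper (extend V There F)" by simp
  ultimately show ?case by (simp add: bounds_Interval del: lower_le_upper)
next
  case (conj f F G)
  have "lower (extend V w H) \<le> upper (extend V w H)" for w H by simp
  from this[of There F] this[of There G] this[of Here F] this[of Here G] conj.IH
  show ?case
    using conj_disj_mono[of f] conj_disj_unit[of f] conj.hyps(1)
    by (auto simp: bounds_Interval simp del: lower_le_upper)
next
  case (disj f F G)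
  have "lower (extend V w H) \<le> upper (extend V w H)" for w H by simp
  from this[of There F] this[of There G] this[of Here F] this[of Here G] disj.IH
  show ?case
    using conj_disj_mono[of f] conj_disj_unit[of f] disj.hyps(1)
    by (auto simp: bounds_Interval simp del: lower_le_upper)
next
  case (impl f F G)
  have "lower (extend V w H) \<le> upper (extend V w H)" for w H by simp
  from this[of There F] this[of There G] this[of Here F] this[of Here G] impl.IH
  show ?case
    using impl_mono[OF impl.hyps(1)] impl_unit[OF impl.hyps(1)]
    by (auto simp: bounds_Interval min_le_iff_disj simp del: lower_le_upper)
qed

lemma extend_bounds:
  assumes "V \<in> valuations \<sigma>"
  shows "lower (extend V w (Const c)) = c" "upper (extend V w (Const c)) = c"
    and "Conj f F G \<in> fuzzy_formulas \<sigma> \<Longrightarrow>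
      lower (extend V w (Conj f F G)) = f (lower (extend V w F)) (lower (extend V w G)) \<and>
      upper (extend V w (Conj f F G)) = f (upper (extend V w F)) (upper (extend V w G))"
    and "Disj f F G \<in> fuzzy_formulas \<sigma> \<Longrightarrow>
      lower (extend V w (Disj f F G)) = f (lower (extend V w F)) (lower (extend V w G)) \<and>
      upper (extend V w (Disj f F G)) = f (upper (extend V w F)) (upper (extend V w G))"
    and "Neg F \<in> fuzzy_formulas \<sigma> \<Longrightarrow>
      lower (extend V Here (Neg F)) = 1 - lower (extend V There F) \<and>
      upper (extend V Here (Neg F)) = 1 - lower (extend V Here F)"
    and "lower (extend V There (Neg F)) = 1 - lower (extend V There F)"
    and "upper (extend V There (Neg F)) = 1 - lower (extend V There F)"
    and "Impl f F G \<in> fuzzy_formulas \<sigma> \<Longrightarrow>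
      lower (extend V Here (Impl f F G)) =
        min (f (lower (extend V Here F)) (lower (extend V Here G)))
            (f (lower (extend V There F)) (lower (extend V There G))) \<and>
      upper (extend V Here (Impl f F G)) = f (lower (extend V Here F)) (upper (extend V Here G))"
    and "Impl f F G \<in> fuzzy_formulas \<sigma> \<Longrightarrow>
      lower (extend V There (Impl f F G)) = f (lower (extend V There F)) (lower (extend V There G)) \<and>
      upper (extend V There (Impl f F G)) = f (lower (extend V There F)) (upper (extend V There G))"
proof -
  have le: "lower (extend V w H) \<le> upper (extend V w H)" for w H by simp
  have B: "0 \<le> lower (extend V w H)" "lower (extend V w H) \<le> 1" "upper (extend V w H) \<le> 1"
    if "H \<in> fuzzy_formulas \<sigma>" for w H
    using extend_ordered[OF that assms] le[of w H] le[of There H] unfolding atomize_conj by (cases w) (simp_all del: lower_le_upper)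
  show "lower (extend V w (Const c)) = c" "upper (extend V w (Const c)) = c"
    "lower (extend V There (Neg F)) = 1 - lower (extend V There F)"
    "upper (extend V There (Neg F)) = 1 - lower (extend V There F)"
    by (simp_all add: bounds_Interval)
  show "lower (extend V w (Conj f F G)) = f (lower (extend V w F)) (lower (extend V w G)) \<and>
      upper (extend V w (Conj f F G)) = f (upper (extend V w F)) (upper (extend V w G))"
    if "Conj f F G \<in> fuzzy_formulas \<sigma>"
    using that by cases (simp add: bounds_Interval conj_disj_mono B)
  show "lower (extend V w (Disj f F G)) = f (lower (extend V w F)) (lower (extend V w G)) \<and>
      upper (extend V w (Disj f F G)) = f (upper (extend V w F)) (upper (extend V w G))"
    if "Disj f F G \<in> fuzzy_formulas \<sigma>"
    using that by cases (simp add: bounds_Interval conj_disj_mono B)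
  show "lower (extend V Here (Neg F)) = 1 - lower (extend V There F) \<and>
      upper (extend V Here (Neg F)) = 1 - lower (extend V Here F)"
    if "Neg F \<in> fuzzy_formulas \<sigma>"
    using that by cases (use extend_ordered[OF _ assms, of F] in \<open>simp add: bounds_Interval\<close>)
  show "lower (extend V Here (Impl f F G)) =
        min (f (lower (extend V Here F)) (lower (extend V Here G)))
            (f (lower (extend V There F)) (lower (extend V There G))) \<and>
      upper (extend V Here (Impl f F G)) = f (lower (extend V Here F)) (upper (extend V Here G))"
    if "Impl f F G \<in> fuzzy_formulas \<sigma>"
    using that by cases (simp add: bounds_Interval impl_mono B min_le_iff_disj)
  show "lower (extend V There (Impl f F G)) = f (lower (extend V There F)) (lower (extend V There G)) \<and>
      upper (extend V There (Impl f F G)) = f (lower (extend V There F)) (upper (extend V There G))"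
    if "Impl f F G \<in> fuzzy_formulas \<sigma>"
    using that by cases (simp add: bounds_Interval impl_mono B)
qed

end

theory Submission
  imports Defs
begin

text \<open>
  The lower bound of a formula depends only on the lower bounds of the atoms, because without
  strong negation no clause lets an upper bound enter a lower one. Hence raising the upper bound
  of a single atom in the world \<open>Here\<close> to 1 keeps a model a model, and \<open>h\<close>-minimality forces
  this change to be trivial.
\<close>

lemma lower_extend_cong:
  assumes "F \<in> fuzzy_formulas \<sigma>" "V \<in> valuations \<sigma>" "V' \<in> valuations \<sigma>"
    and "\<And>w a. a \<in> \<sigma> \<Longrightarrow> lower (V' (w, a)) = lower (V (w, a))"
  shows "lower (extend V' w F) = lower (extend V w F)"
  using assms(1)
\<comment> \<open>The world is generalised because lower bounds of negations and implications in
  \<open>Here\<close> refer to subformulas in \<open>There\<close>.\<close>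
proof (induction arbitrary: w)
  case (atom a)
  then show ?case by (simp add: assms(4))
next
  case (const c)
  then show ?case by simp
next
  case (neg F)
  \<comment> \<open>Membership of the compound formula unlocks \<open>extend_bounds\<close>, where
    the order of the two bounds is already settled; unfolding \<open>extend\<close> would leave
    \<open>lower (Interval ...)\<close> unevaluated.\<close>
  then have "Neg F \<in> fuzzy_formulas \<sigma>" by (intro fuzzy_formulas.neg)
  with neg.IH show ?case
    by (cases w) (simp_all add: extend_bounds[OF assms(2)] extend_bounds[OF assms(3)] del: extend.simps)
next
  case (conj f F G)
  then have "Conj f F G \<in> fuzzy_formulas \<sigma>" by (intro fuzzy_formulas.conj)
  with conj.IH show ?case
    by (simp add: extend_bounds[OF assms(2)] extend_bounds[OF assms(3)] del: extend.simps)
next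
  case (disj f F G)
  then have "Disj f F G \<in> fuzzy_formulas \<sigma>" by (intro fuzzy_formulas.disj)
  with disj.IH show ?case
    by (simp add: extend_bounds[OF assms(2)] extend_bounds[OF assms(3)] del: extend.simps)
next
  case (impl f F G)
  then have "Impl f F G \<in> fuzzy_formulas \<sigma>" by (intro fuzzy_formulas.impl)
  with impl.IH show ?case
    by (cases w) (simp_all add: extend_bounds[OF assms(2)] extend_bounds[OF assms(3)] del: extend.simps)
qed

lemma valuation_bounds:
  assumes "V \<in> valuations \<sigma>" "a \<in> \<sigma>"
  shows "0 \<le> lower (V (w, a))" "upper (V (w, a)) \<le> 1"
proof -
  have "set_of (V (w, a)) \<subseteq> {0..1}"
    using assms by (auto simp: valuations_def PiE_def Pi_def)
  then show "0 \<le> lower (V (w, a))" "upper (V (w, a)) \<le> 1"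
    by (auto simp: set_of_eq)
qed

lemma h_minimal_model_upper:
  assumes F: "F \<in> fuzzy_formulas \<sigma>" and V: "h_minimal_model \<sigma> F V" and a: "a \<in> \<sigma>"
  shows "upper (V (Here, a)) = 1"
proof (rule ccontr)
  \<comment> \<open>Keeping the lower bound makes \<open>lower_extend_cong\<close> applicable; 1 is
    the largest upper bound a valuation allows.\<close>
  define I where "I = Interval (lower (V (Here, a)), 1)"
  define V' where "V' = V((Here, a) := I)"
  assume neq: "upper (V (Here, a)) \<noteq> 1"
  have val: "V \<in> valuations \<sigma>" and mod: "lower (extend V Here F) = 1"
    using V by (auto simp: h_minimal_model_def model_def)
  have u: "upper (V (Here, a)) \<le> 1" and l: "0 \<le> lower (V (Here, a))"
    using valuation_bounds[OF val a] by auto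
  have "lower (V (Here, a)) \<le> 1"
    using lower_le_upper[of "V (Here, a)"] u by linarith
  then have I: "lower I = lower (V (Here, a))" "upper I = 1"
    by (simp_all add: I_def bounds_Interval)
  \<comment> \<open>This inclusion serves twice: the \<open>There\<close> interval stays inside the
    widened \<open>Here\<close> interval, and \<open>V'\<close> lies below \<open>V\<close>, as
    \<open>preceq\<close> reverses inclusion in \<open>Here\<close>.\<close>
  have sub: "set_of (V (Here, a)) \<subseteq> set_of I"
    using u by (auto simp: set_of_eq I)
  have "set_of I \<subseteq> {0..1}"
    using l by (auto simp: set_of_eq I)
  then have val': "V' \<in> valuations \<sigma>"
    using val a sub by (fastforce simp: valuations_def V'_def PiE_iff extensional_def)
  have "lower (extend V' Here F) = lower (extend V Here F)"
    using lower_extend_cong[OF F val val'] I by (simp add: V'_def)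
  then have "model \<sigma> F V'"
    using val' mod by (simp add: model_def)
  moreover have "V' \<noteq> V"
    using I neq by (auto simp: V'_def fun_eq_iff)
  then have "prec \<sigma> V' V"
    using sub by (auto simp: prec_def preceq_def V'_def)
  ultimately show False
    using V by (auto simp: h_minimal_model_def)
qed

theorem lemma1:
  fixes \<sigma> :: "'a set" and F :: "'a fuzzy" and V :: "'a valuation"
  assumes "F \<in> fuzzy_formulas \<sigma>"
    and "fuzzy_equilibrium_model \<sigma> F V"
  shows "\<forall>a\<in>\<sigma>. upper (V (Here, a)) = 1 \<and> upper (V (There, a)) = 1"
  \<comment> \<open>Minimality settles \<open>Here\<close>; equality of the two worlds in an
    equilibrium model carries the bound to \<open>There\<close>.\<close>
  using assms h_minimal_model_upper[OF assms(1)]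
  by (metis fuzzy_equilibrium_model_def)

end
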